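(* Let $d\ge2$ be an integer, let $L\in\mathbb{N}_0$, and let $\mathcal{G}\subset C^\infty(\mathbb{S}^{d-1})$ be a (finite-dimensional, linear) ansatz space such that 1) $\mathcal{G}$ is rotational invariant, i.e. $\{g\circ\mathbf{R} : g\in\mathcal{G}\}=\mathcal{G}$ for all rotation matrices $\mathbf{R}\in\mathcal{SO}(d)$, and 2) every $p\in\mathcal{P}_L(\mathbb{R}^{d-1})$ is the Taylor series of order $L$ of the pullback function $g^*$ of some $g\in\mathcal{G}$, i.e. $T_L(\mathcal{G})=\mathcal{P}_L(\mathbb{R}^{d-1})$. Then for all $f\in C^{L+1}(\mathbb{S}^{d-1})$ and all $y\in\mathbb{S}^{d-1}$, the error of the local best approximation of $f$ from $\mathcal{G}$ on the spherical cap $C_\delta(y)$ satisfies $$E_\delta(\mathcal{G},f,y)=\mathcal{O}(\delta^{L+1})\qquad\text{as }\delta\to0 .$$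
   Context: $\mathbb{S}^{d-1}=\{y\in\mathbb{R}^d : \|y\|_2=1\}$, $e_d=(0,\dots,0,1)$. Functions take values in $\mathbb{K}\in\{\mathbb{R},\mathbb{C}\}$, and all function and polynomial spaces are linear over the field $\mathbb{K}$ that $f$ maps into. $\mathcal{SO}(d)$ is the group of rotation matrices of $\mathbb{R}^d$. The great circle distance is $d(y,z)=\arccos(\langle y,z\rangle)$, $C_\delta(y)=\{z\in\mathbb{S}^{d-1} : d(y,z)<\delta\}$, and $E_\delta(\mathcal{G},f,y)=\inf_{g\in\mathcal{G}}\sup_{z\in C_\delta(y)}|f(z)-g(z)|$. $\mathcal{P}_L(\mathbb{R}^{d-1})$ is the space of polynomials on $\mathbb{R}^{d-1}$ of total degree at most $L$. The projection $\pi\colon B_1(0)\to C_{\pi/2}(e_d)$, with $B_1(0)\subset\mathbb{R}^{d-1}$ the open unit ball, is $\pi(x_1,\dots,x_{d-1})=(x_1,\dots,x_{d-1},\sqrt{1-\|x\|_2^2})$. The pullback of a function $g$ on the sphere is $g^*=g\circ\pi\colon B_1(0)\to\mathbb{K}$. The map $T_L\colon C^L(\mathbb{S}^{d-1})\to\mathcal{P}_L(\mathbb{R}^{d-1})$ sends $g$ to the order-$L$ Taylor polynomial of its pullback at $0$: $T_L(g)(x)=\sum_{\alpha\in\mathbb{N}_0^{d-1},\,|\alpha|\le L}\frac{(g^* )^{(\alpha)}(0)}{\alpha!}x^\alpha$. *)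

theory Defs
  imports
    "HOL-Analysis.Analysis"
    "HOL-Library.Function_Algebras"
    "HOL-Library.Landau_Symbols"
begin

text \<open>
  For an index type \<open>'n\<close> with \<open>d - 1\<close> elements, \<open>\<real>\<^bsup>d-1\<^esup>\<close> is \<^typ>\<open>real ^ 'n\<close> and \<open>\<real>\<^bsup>d\<^esup>\<close> is
  \<^typ>\<open>real ^ ('n option)\<close>, the index \<^term>\<open>None\<close> being the last coordinate \<open>d\<close>. As \<open>'n\<close> is
  finite and nonempty, this covers exactly the dimensions \<open>d \<ge> 2\<close>.
\<close>

subsection \<open>The scalar field\<close>

text \<open>
  By the theorem of Gelfand and Mazur, the instances of this class are \<open>\<real>\<close> and \<open>\<complex>\<close>, up to
  isometric isomorphism.
\<close>

class real_or_complex = real_normed_field + euclidean_space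

instance real :: real_or_complex ..
instance complex :: real_or_complex ..

text \<open>Functions into a field \<open>'k\<close>, with pointwise operations, as a vector space over \<open>'k\<close>.\<close>

definition fscale :: "'k::field \<Rightarrow> ('a \<Rightarrow> 'k) \<Rightarrow> 'a \<Rightarrow> 'k" where
  "fscale c g = (\<lambda>x. c * g x)"

global_interpretation kfun: vector_space "fscale :: 'k::field \<Rightarrow> ('a \<Rightarrow> 'k) \<Rightarrow> _"
  by unfold_locales (auto simp: fscale_def fun_eq_iff algebra_simps)

definition finite_dim_subspace :: "('a \<Rightarrow> 'k::field) set \<Rightarrow> bool" where
  "finite_dim_subspace G \<longleftrightarrow> kfun.subspace G \<and> (\<exists>B. finite B \<and> G = kfun.span B)"

subsection \<open>Functions of class \<open>C\<^sup>k\<close>\<close>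

text \<open>Intended for open sets \<open>U\<close>.\<close>

primrec Ck_on ::
  "nat \<Rightarrow> 'a::euclidean_space set \<Rightarrow> ('a \<Rightarrow> 'b::real_normed_vector) \<Rightarrow> bool" where
  "Ck_on 0 U F \<longleftrightarrow> continuous_on U F"
| "Ck_on (Suc k) U F \<longleftrightarrow>
     (\<forall>x\<in>U. F differentiable (at x)) \<and>
     (\<forall>b\<in>Basis. Ck_on k U (\<lambda>x. frechet_derivative F (at x) b))"

text \<open>
  A function on the sphere is represented by its extension by zero to the whole space, so that
  equality of representatives is equality on the sphere. It is of class \<open>C\<^sup>k\<close> if it is locally the
  restriction of a \<open>C\<^sup>k\<close> function on an open subset of the ambient space.
\<close>

definition Ck_sphere :: "nat \<Rightarrow> ('a::euclidean_space \<Rightarrow> 'k::real_normed_vector) set" where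
  "Ck_sphere k = {f.
     (\<forall>y\<in>sphere 0 1. \<exists>U F. open U \<and> y \<in> U \<and> Ck_on k U F \<and> (\<forall>z\<in>U \<inter> sphere 0 1. F z = f z)) \<and>
     (\<forall>x. x \<notin> sphere 0 1 \<longrightarrow> f x = 0)}"

definition Cinf_sphere :: "('a::euclidean_space \<Rightarrow> 'k::real_normed_vector) set" where
  "Cinf_sphere = (\<Inter>k. Ck_sphere k)"

subsection \<open>Local best approximation\<close>

definition gc_dist :: "'a::real_inner \<Rightarrow> 'a \<Rightarrow> real" where
  "gc_dist y z = arccos (y \<bullet> z)"

definition cap :: "real \<Rightarrow> 'a::real_inner \<Rightarrow> 'a set" where
  "cap \<delta> y = {z \<in> sphere 0 1. gc_dist y z < \<delta>}"

definition local_error ::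
  "real \<Rightarrow> ('a::real_inner \<Rightarrow> 'k::real_normed_vector) set \<Rightarrow> ('a \<Rightarrow> 'k) \<Rightarrow> 'a \<Rightarrow> real" where
  "local_error \<delta> G f y = (INF g\<in>G. SUP z\<in>cap \<delta> y. norm (f z - g z))"

definition rotation_invariant :: "(real ^ 'm \<Rightarrow> 'k) set \<Rightarrow> bool" where
  "rotation_invariant G \<longleftrightarrow>
     (\<forall>R::real^'m^'m. rotation_matrix R \<longrightarrow> {g \<circ> (\<lambda>x. R *v x) | g. g \<in> G} = G)"

subsection \<open>Pullback and Taylor polynomial\<close>

text \<open>Only the values on the open unit ball are meaningful.\<close>

definition hemisphere_param :: "real ^ 'n \<Rightarrow> real ^ ('n option)" where
  "hemisphere_param x = (\<chi> i. case i of None \<Rightarrow> sqrt (1 - (norm x)\<^sup>2) | Some j \<Rightarrow> x $ j)"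

definition pullback :: "(real ^ ('n option) \<Rightarrow> 'k) \<Rightarrow> real ^ 'n \<Rightarrow> 'k" where
  "pullback g = g \<circ> hemisphere_param"

definition partial_deriv ::
  "'n::finite \<Rightarrow> (real ^ 'n \<Rightarrow> 'k::real_normed_vector) \<Rightarrow> real ^ 'n \<Rightarrow> 'k" where
  "partial_deriv i h x = frechet_derivative h (at x) (axis i 1)"

text \<open>
  Multi-indices are functions \<open>\<alpha> :: 'n \<Rightarrow> nat\<close>. The linear order on \<open>'n\<close> only fixes the order of
  differentiation, \<open>\<partial>\<^sub>1\<^bsup>\<alpha>\<^sub>1\<^esup> \<dots> \<partial>\<^sub>n\<^bsup>\<alpha>\<^sub>n\<^esup>\<close>.
\<close>

definition multi_deriv ::
  "('n \<Rightarrow> nat) \<Rightarrow> (real ^ ('n::{finite,linorder}) \<Rightarrow> 'k::real_normed_vector) \<Rightarrow>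
   real ^ ('n::{finite,linorder}) \<Rightarrow> 'k" where
  "multi_deriv \<alpha> h = foldr (\<lambda>i. partial_deriv i ^^ \<alpha> i) (sorted_list_of_set UNIV) h"

definition multi_indices :: "nat \<Rightarrow> ('n::finite \<Rightarrow> nat) set" where
  "multi_indices L = {\<alpha>. (\<Sum>i\<in>UNIV. \<alpha> i) \<le> L}"

definition multi_fact :: "('n::finite \<Rightarrow> nat) \<Rightarrow> nat" where
  "multi_fact \<alpha> = (\<Prod>i\<in>UNIV. fact (\<alpha> i))"

definition monomial :: "('n::finite \<Rightarrow> nat) \<Rightarrow> real ^ 'n \<Rightarrow> 'k::real_normed_field" where
  "monomial \<alpha> x = of_real (\<Prod>i\<in>UNIV. (x $ i) ^ \<alpha> i)"

definition polys :: "nat \<Rightarrow> (real ^ 'n \<Rightarrow> 'k::real_normed_field) set" where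
  "polys L = kfun.span (monomial ` multi_indices L)"

definition taylor_poly ::
  "nat \<Rightarrow> (real ^ ('n option) \<Rightarrow> 'k::real_normed_field) \<Rightarrow>
   real ^ ('n::{finite,linorder}) \<Rightarrow> 'k" where
  "taylor_poly L g x =
     (\<Sum>\<alpha>\<in>multi_indices L. multi_deriv \<alpha> (pullback g) 0 / of_nat (multi_fact \<alpha>) * monomial \<alpha> x)"

end

theory Submission
  imports Defs
begin

text \<open>
  Taylor's formula is obtained one variable at a time, in the order in which the multi-index
  derivatives are taken, so that no symmetry of mixed partial derivatives is needed. A rotation
  \<open>R\<close> with \<open>R e\<^sub>d = y\<close> moves the problem to the pole. There some \<open>g \<in> G\<close> has the same
  Taylor polynomial as \<open>f \<circ> R\<close>, so that the pullbacks of both functions differ from that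
  polynomial, hence from each other, by \<open>O(\<parallel>x\<parallel>\<^bsup>L+1\<^esup>)\<close>. A point of the cap of radius \<open>\<delta>\<close> around
  the pole is the image of some \<open>x\<close> with \<open>\<parallel>x\<parallel> \<le> sin \<delta> \<le> \<delta>\<close>, and \<open>g \<circ> R\<^sup>T\<close>
  approximates \<open>f\<close> around \<open>y\<close>.
\<close>

subsection \<open>Calculus of \<open>C\<^sup>k\<close> functions\<close>

text \<open>A derivative depends only on the values near the point, so on an open set agreement of
  functions passes to their derivatives and the induction continues.\<close>

lemma Ck_on_cong:
  assumes "open U" "Ck_on k U F" "\<And>x. x \<in> U \<Longrightarrow> F x = H x"
  shows "Ck_on k U H"
  using assms
proof (induction k arbitrary: F H)
  case 0
  then show ?case by (auto cong: continuous_on_cong)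
next
  case (Suc k)
  have d: "H differentiable (at x) \<and> frechet_derivative H (at x) = frechet_derivative F (at x)"
    if "x \<in> U" for x
  proof -
    have "(F has_derivative frechet_derivative F (at x)) (at x)"
      using Suc.prems(2) that frechet_derivative_works by auto
    then have "(H has_derivative frechet_derivative F (at x)) (at x)"
      by (rule has_derivative_transform_within_open[OF _ assms(1) that]) (use Suc.prems(3) in auto)
    then show ?thesis
      using differentiableI frechet_derivative_at by metis
  qed
  have "Ck_on k U (\<lambda>x. frechet_derivative H (at x) b)" if "b \<in> Basis" for b
    by (rule Suc.IH[OF assms(1), of "\<lambda>x. frechet_derivative F (at x) b"])
      (use Suc.prems(2) d that in auto)
  with d show ?case by simp
qed

text \<open>Allows the derivative to be given by an explicit formula \<open>F'\<close> in place of
  the choice made by \<open>frechet_derivative\<close>. The inductive closure proofs below only have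
  to supply such a formula.\<close>

lemma Ck_on_SucI:
  assumes "open U" "\<And>x. x \<in> U \<Longrightarrow> (F has_derivative F' x) (at x)"
    and "\<And>b. b \<in> Basis \<Longrightarrow> Ck_on k U (\<lambda>x. F' x b)"
  shows "Ck_on (Suc k) U F"
proof -
  have "F' x = frechet_derivative F (at x)" if "x \<in> U" for x
    using assms(2)[OF that] frechet_derivative_at by blast
  then show ?thesis
    using assms Ck_on_cong[OF assms(1) assms(3)]
    by (auto simp: differentiable_def)
qed

lemma Ck_on_Suc_has_derivative:
  assumes "Ck_on (Suc k) U F" "x \<in> U"
  shows "(F has_derivative frechet_derivative F (at x)) (at x)"
  using assms frechet_derivative_works by auto

lemma Ck_on_SucD: "Ck_on (Suc k) U F \<Longrightarrow> Ck_on k U F"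
proof (induction k arbitrary: F)
  case 0
  then show ?case
    by (simp add: continuous_at_imp_continuous_on differentiable_imp_continuous_within)
next
  case (Suc k)
  have "Ck_on k U (\<lambda>x. frechet_derivative F (at x) b)" if "b \<in> Basis" for b
    using Suc.prems that by (intro Suc.IH) simp
  then show ?case
    using Suc.prems by simp
qed

lemma Ck_on_imp_continuous_on: "Ck_on k U F \<Longrightarrow> continuous_on U F"
proof (induction k)
  case (Suc k)
  then show ?case using Ck_on_SucD by blast
qed simp

lemma Ck_on_subset: "Ck_on k U F \<Longrightarrow> V \<subseteq> U \<Longrightarrow> Ck_on k V F"
  by (induction k arbitrary: F) (auto intro: continuous_on_subset)

lemma Ck_on_const: "open U \<Longrightarrow> Ck_on k U (\<lambda>x. c)"
proof (induction k arbitrary: c)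
  case (Suc k)
  show ?case
    by (rule Ck_on_SucI[OF Suc.prems, where F' = "\<lambda>_ _. 0"]) (use Suc in auto)
qed simp

lemma Ck_on_ident: "open U \<Longrightarrow> Ck_on k U (\<lambda>x. x)"
proof (cases k)
  case (Suc m)
  assume "open U"
  then have "Ck_on (Suc m) U (\<lambda>x. x)"
    by (rule Ck_on_SucI[where F' = "\<lambda>_ h. h"]) (auto intro: Ck_on_const[OF \<open>open U\<close>])
  then show ?thesis using Suc by simp
qed simp

lemma Ck_on_bounded_linear:
  assumes "open U" "Ck_on k U F" "bounded_linear T"
  shows "Ck_on k U (\<lambda>x. T (F x))"
  using assms(2)
proof (induction k arbitrary: F)
  case 0
  then show ?case
    by (auto intro!: bounded_linear.continuous_on[OF assms(3)])
next
  case (Suc k)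
  show ?case
  proof (rule Ck_on_SucI[OF assms(1)])
    show "((\<lambda>x. T (F x)) has_derivative (\<lambda>h. T (frechet_derivative F (at x) h))) (at x)"
      if "x \<in> U" for x
      by (rule bounded_linear.has_derivative[OF assms(3) Ck_on_Suc_has_derivative[OF Suc.prems that]])
  next
    show "Ck_on k U (\<lambda>x. T (frechet_derivative F (at x) b))" if "b \<in> Basis" for b
      using Suc.prems that by (intro Suc.IH) simp
  qed
qed

lemma Ck_on_add:
  assumes "open U" "Ck_on k U F" "Ck_on k U H"
  shows "Ck_on k U (\<lambda>x. F x + H x)"
  using assms(2,3)
proof (induction k arbitrary: F H)
  case 0
  then show ?case by (simp add: continuous_on_add)
next
  case (Suc k)
  show ?case
  proof (rule Ck_on_SucI[OF assms(1)])
    show "((\<lambda>x. F x + H x) has_derivative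
        (\<lambda>h. frechet_derivative F (at x) h + frechet_derivative H (at x) h)) (at x)"
      if "x \<in> U" for x
      by (rule has_derivative_add[OF Ck_on_Suc_has_derivative[OF Suc.prems(1) that]
            Ck_on_Suc_has_derivative[OF Suc.prems(2) that]])
  next
    show "Ck_on k U (\<lambda>x. frechet_derivative F (at x) b + frechet_derivative H (at x) b)"
      if "b \<in> Basis" for b
      using Suc.prems that by (intro Suc.IH) auto
  qed
qed

lemma Ck_on_sum:
  assumes "open U" "\<And>i. i \<in> I \<Longrightarrow> Ck_on k U (F i)"
  shows "Ck_on k U (\<lambda>x. \<Sum>i\<in>I. F i x)"
  using assms(2)
proof (induction I rule: infinite_finite_induct)
  case (insert i I)
  then show ?case by (auto intro!: Ck_on_add[OF assms(1)])
qed (auto intro: Ck_on_const[OF assms(1)])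

text \<open>In each term of the product rule one factor is a derivative of class \<open>k\<close>,
  and the other is an original function whose class is lowered by \<open>Ck_on_SucD\<close>.\<close>

lemma Ck_on_scaleR:
  assumes "open U" "Ck_on k U a" "Ck_on k U F"
  shows "Ck_on k U (\<lambda>x. a x *\<^sub>R F x)"
  using assms(2,3)
proof (induction k arbitrary: a F)
  case 0
  then show ?case by (simp add: continuous_on_scaleR)
next
  case (Suc k)
  show ?case
  proof (rule Ck_on_SucI[OF assms(1)])
    show "((\<lambda>x. a x *\<^sub>R F x) has_derivative
        (\<lambda>h. a x *\<^sub>R frechet_derivative F (at x) h + frechet_derivative a (at x) h *\<^sub>R F x)) (at x)"
      if "x \<in> U" for x
      by (rule has_derivative_scaleR[OF Ck_on_Suc_has_derivative[OF Suc.prems(1) that]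
            Ck_on_Suc_has_derivative[OF Suc.prems(2) that]])
  next
    show "Ck_on k U (\<lambda>x. a x *\<^sub>R frechet_derivative F (at x) b + frechet_derivative a (at x) b *\<^sub>R F x)"
      if "b \<in> Basis" for b
    proof (rule Ck_on_add[OF assms(1)])
      show "Ck_on k U (\<lambda>x. a x *\<^sub>R frechet_derivative F (at x) b)"
        by (rule Suc.IH[OF Ck_on_SucD[OF Suc.prems(1)]]) (use Suc.prems(2) that in simp)
      show "Ck_on k U (\<lambda>x. frechet_derivative a (at x) b *\<^sub>R F x)"
        by (rule Suc.IH[OF _ Ck_on_SucD[OF Suc.prems(2)]]) (use Suc.prems(1) that in simp)
    qed
  qed
qed

text \<open>Expanding the inner derivative in \<open>Basis\<close> turns the chain rule into a sum
  of scalar multiples of partial derivatives of \<open>F\<close>, composed with \<open>p\<close>.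
  These compositions are covered by the induction hypothesis, which is therefore kept general in
  \<open>F\<close>.\<close>

lemma Ck_on_compose:
  fixes F :: "'a::euclidean_space \<Rightarrow> 'b::real_normed_vector"
  assumes "open U" "Ck_on k V F" "Ck_on k U p" "p ` U \<subseteq> V"
  shows "Ck_on k U (\<lambda>x. F (p x))"
  using assms(2,3)
proof (induction k arbitrary: F)
  case 0
  then have "continuous_on V F" "continuous_on U p" by simp_all
  from continuous_on_compose2[OF this assms(4)] show ?case by simp
next
  case (Suc k)
  let ?F' = "\<lambda>x. frechet_derivative F (at (p x))" and ?p' = "\<lambda>x. frechet_derivative p (at x)"
  have dF: "(F has_derivative ?F' x) (at (p x))" if "x \<in> U" for x
    using Ck_on_Suc_has_derivative[OF Suc.prems(1)] assms(4) that by blast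
  show ?case
  proof (rule Ck_on_SucI[OF assms(1)])
    show "((\<lambda>x. F (p x)) has_derivative (\<lambda>h. \<Sum>c\<in>Basis. (?p' x h \<bullet> c) *\<^sub>R ?F' x c)) (at x)"
      if "x \<in> U" for x
    proof -
      have "((\<lambda>x. F (p x)) has_derivative (\<lambda>h. ?F' x (?p' x h))) (at x)"
        by (rule has_derivative_compose[OF Ck_on_Suc_has_derivative[OF Suc.prems(2) that] dF[OF that]])
      moreover have "(\<lambda>h. ?F' x (?p' x h)) = (\<lambda>h. \<Sum>c\<in>Basis. (?p' x h \<bullet> c) *\<^sub>R ?F' x c)"
      proof
        fix h
        let ?v = "?p' x h"
        have l: "linear (?F' x)" using dF[OF that] has_derivative_linear by blast
        have "?F' x ?v = ?F' x (\<Sum>c\<in>Basis. (?v \<bullet> c) *\<^sub>R c)"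
          by (simp add: euclidean_representation)
        also have "\<dots> = (\<Sum>c\<in>Basis. (?v \<bullet> c) *\<^sub>R ?F' x c)"
          by (simp add: linear_sum[OF l] linear_cmul[OF l])
        finally show "?F' x ?v = (\<Sum>c\<in>Basis. (?v \<bullet> c) *\<^sub>R ?F' x c)" .
      qed
      ultimately show ?thesis by (simp only:)
    qed
  next
    fix b :: 'c
    assume b: "b \<in> Basis"
    have "Ck_on k U (\<lambda>x. ?F' x c)" if "c \<in> Basis" for c
      using Suc.prems(1) that by (intro Suc.IH[OF _ Ck_on_SucD[OF Suc.prems(2)]]) simp
    moreover have "Ck_on k U (\<lambda>x. ?p' x b \<bullet> c)" for c
      by (rule Ck_on_bounded_linear[OF assms(1) _ bounded_linear_inner_left])
        (use Suc.prems(2) b in simp)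
    ultimately show "Ck_on k U (\<lambda>x. \<Sum>c\<in>Basis. (?p' x b \<bullet> c) *\<^sub>R ?F' x c)"
      by (intro Ck_on_sum[OF assms(1)] Ck_on_scaleR[OF assms(1)])
  qed
qed

subsection \<open>Taylor's formula along the coordinates\<close>

lemma vector_derivative_bound_mvt:
  fixes f :: "real \<Rightarrow> 'b::real_normed_vector"
  assumes "\<And>t. \<bar>t\<bar> \<le> \<bar>s\<bar> \<Longrightarrow> (f has_vector_derivative f' t) (at t)"
    and "\<And>t. \<bar>t\<bar> \<le> \<bar>s\<bar> \<Longrightarrow> norm (f' t) \<le> M"
  shows "norm (f s - f 0) \<le> M * \<bar>s\<bar>"
proof -
  have "norm (f s - f 0) \<le> M * norm (s - 0)"
  \<comment> \<open>The symmetric interval treats both signs of \<open>s\<close> at once.\<close>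
  proof (rule differentiable_bound[where S = "{- \<bar>s\<bar>..\<bar>s\<bar>}" and f' = "\<lambda>t h. h *\<^sub>R f' t"])
    fix t assume "t \<in> {- \<bar>s\<bar>..\<bar>s\<bar>}"
    then have t: "\<bar>t\<bar> \<le> \<bar>s\<bar>" by auto
    show "(f has_derivative (\<lambda>h. h *\<^sub>R f' t)) (at t within {- \<bar>s\<bar>..\<bar>s\<bar>})"
      using assms(1)[OF t] has_derivative_at_withinI unfolding has_vector_derivative_def by blast
    show "onorm (\<lambda>h. h *\<^sub>R f' t) \<le> M"
      using assms(2)[OF t] by (intro onorm_le) (simp add: mult.commute[of M] mult_left_mono)
  qed auto
  then show ?thesis by simp
qed

text \<open>The remainder vanishes at 0, and its derivative is the remainder of one order less for
  the shifted family \<open>F (Suc k)\<close>. The mean value inequality thus gains one power of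
  \<open>s\<close> per induction step. The factorial in the sharp constant is given up, as only the
  order matters.\<close>

lemma taylor_remainder_bound:
  fixes F :: "nat \<Rightarrow> real \<Rightarrow> 'b::real_normed_vector"
  assumes "\<And>k t. k \<le> n \<Longrightarrow> \<bar>t\<bar> \<le> \<bar>s\<bar> \<Longrightarrow> (F k has_vector_derivative F (Suc k) t) (at t)"
    and "\<And>t. \<bar>t\<bar> \<le> \<bar>s\<bar> \<Longrightarrow> norm (F (Suc n) t) \<le> B"
  shows "norm (F 0 s - (\<Sum>k\<le>n. (s ^ k / fact k) *\<^sub>R F k 0)) \<le> B * \<bar>s\<bar> ^ Suc n"
  using assms
proof (induction n arbitrary: F s)
  case 0
  then show ?case
    using vector_derivative_bound_mvt[of s "F 0" "F (Suc 0)" B] by simp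
next
  case (Suc n)
  let ?R = "\<lambda>t. F 0 t - (\<Sum>k\<le>Suc n. (t ^ k / fact k) *\<^sub>R F k 0)"
  let ?R' = "\<lambda>t. F (Suc 0) t - (\<Sum>k\<le>n. (t ^ k / fact k) *\<^sub>R F (Suc k) 0)"
  have "norm (?R s - ?R 0) \<le> (B * \<bar>s\<bar> ^ Suc n) * \<bar>s\<bar>"
  proof (rule vector_derivative_bound_mvt[where f' = ?R'])
    fix t :: real
    assume t: "\<bar>t\<bar> \<le> \<bar>s\<bar>"
    have pw: "((\<lambda>t. t ^ Suc k / fact (Suc k)) has_real_derivative t ^ k / fact k) (at t)" for k
    proof -
      have "((\<lambda>t. t ^ Suc k) has_real_derivative real (Suc k) * t ^ k) (at t)"
        using DERIV_pow[of "Suc k" t] by simp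
      from DERIV_cdivide[OF this, of "fact (Suc k)"] show ?thesis
        by (simp add: fact_Suc del: of_nat_Suc power_Suc)
    qed
    have tm: "((\<lambda>t. (t ^ Suc k / fact (Suc k)) *\<^sub>R c) has_vector_derivative (t ^ k / fact k) *\<^sub>R c) (at t)"
      for k and c :: 'b
      using has_vector_derivative_scaleR[OF pw[of k] has_vector_derivative_const[of c "at t"]] by simp
    \<comment> \<open>The constant term is split off, so that differentiating each remaining term
      lowers its exponent and factorial by one.\<close>
    have "((\<lambda>t. F 0 t - (F 0 0 + (\<Sum>k\<le>n. (t ^ Suc k / fact (Suc k)) *\<^sub>R F (Suc k) 0)))
        has_vector_derivative F (Suc 0) t - (0 + (\<Sum>k\<le>n. (t ^ k / fact k) *\<^sub>R F (Suc k) 0))) (at t)"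
      using Suc.prems(1)[of 0 t] t
      by (intro has_vector_derivative_diff has_vector_derivative_add has_vector_derivative_sum tm
          has_vector_derivative_const) simp
    then show "(?R has_vector_derivative ?R' t) (at t)"
      by (simp add: sum.atMost_Suc_shift del: power_Suc fact_Suc sum.atMost_Suc)
    have "0 \<le> B" using order_trans[OF norm_ge_zero Suc.prems(2)[of 0]] by simp
    have "norm (?R' t) \<le> B * \<bar>t\<bar> ^ Suc n"
      by (rule Suc.IH[where F = "\<lambda>k. F (Suc k)"]) (use Suc.prems t in auto)
    also have "\<dots> \<le> B * \<bar>s\<bar> ^ Suc n"
      using t \<open>0 \<le> B\<close> by (intro mult_left_mono power_mono) auto
    finally show "norm (?R' t) \<le> B * \<bar>s\<bar> ^ Suc n" .
  qed
  moreover have "?R 0 = 0"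
    by (simp add: sum.atMost_Suc_shift del: sum.atMost_Suc)
  ultimately show ?case by (simp add: mult_ac)
qed

section \<open>Iterated partial derivatives and multi-indices\<close>

lemma Ck_on_partial_deriv:
  fixes F :: "real ^ 'n::finite \<Rightarrow> 'b::real_normed_vector"
  assumes "Ck_on (Suc k) U F"
  shows "Ck_on k U (partial_deriv i F)"
  using assms axis_in_Basis_iff[of i "1::real"] by (auto simp: partial_deriv_def[abs_def])

lemma Ck_on_partial_deriv_funpow:
  fixes F :: "real ^ 'n::finite \<Rightarrow> 'b::real_normed_vector"
  assumes "Ck_on (m + k) U F"
  shows "Ck_on k U ((partial_deriv i ^^ m) F)"
  using assms
proof (induction m arbitrary: k)
  case (Suc m)
  have "Ck_on (Suc k) U ((partial_deriv i ^^ m) F)"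
    by (rule Suc.IH) (use Suc.prems in \<open>simp only: add_Suc add_Suc_right\<close>)
  then show ?case by (simp add: Ck_on_partial_deriv)
qed simp

lemma finite_multi_indices: "finite (multi_indices L :: ('n::finite \<Rightarrow> nat) set)"
proof (rule finite_subset)
  show "multi_indices L \<subseteq> (UNIV :: 'n set) \<rightarrow>\<^sub>E {..L}"
  proof
    fix \<alpha> :: "'n \<Rightarrow> nat"
    assume "\<alpha> \<in> multi_indices L"
    then have "\<alpha> i \<le> L" for i
      using member_le_sum[of i UNIV \<alpha>] by (auto simp: multi_indices_def)
    then show "\<alpha> \<in> UNIV \<rightarrow>\<^sub>E {..L}" by auto
  qed
qed (simp add: finite_PiE)

text \<open>This is the factor x^\<alpha>/\<alpha>! of the Taylor polynomial. It is real-valued and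
  applied by \<open>scaleR\<close>, so the formula makes sense in any real normed space; the product
  form lets one coordinate be split off.\<close>

definition taylor_weight :: "('n::finite \<Rightarrow> nat) \<Rightarrow> real ^ 'n \<Rightarrow> real" where
  "taylor_weight \<alpha> x = (\<Prod>i\<in>UNIV. (x $ i) ^ \<alpha> i / fact (\<alpha> i))"

definition multi_indices_in :: "'n set \<Rightarrow> nat \<Rightarrow> ('n::finite \<Rightarrow> nat) set" where
  "multi_indices_in I L = {\<alpha> \<in> multi_indices L. \<forall>j. j \<notin> I \<longrightarrow> \<alpha> j = 0}"

text \<open>A multi-index is matched with the pair of its exponent \<open>k\<close> at
  \<open>i\<close> and its remaining part, whose degree budget is then \<open>L - k\<close>. This is
  the combinatorial form of expanding in one more variable.\<close>

lemma sum_multi_indices_in_insert: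
  fixes h :: "('n::finite \<Rightarrow> nat) \<Rightarrow> 'b::comm_monoid_add"
  assumes "i \<notin> I"
  shows "(\<Sum>\<alpha>\<in>multi_indices_in (insert i I) L. h \<alpha>) =
    (\<Sum>k\<le>L. \<Sum>\<beta>\<in>multi_indices_in I (L - k). h (\<beta>(i := k)))"
proof -
  \<comment> \<open>Degrees are compared in additive form to avoid truncated subtraction on
    \<open>nat\<close>.\<close>
  have s: "sum (\<alpha>(i := k)) UNIV + \<alpha> i = sum \<alpha> UNIV + k" for \<alpha> :: "'n \<Rightarrow> nat" and k
    by (simp add: sum.remove[of UNIV i])
  have fin: "finite (multi_indices_in I m)" for m
    by (rule finite_subset[OF _ finite_multi_indices[of m]]) (auto simp: multi_indices_in_def)
  have "(\<Sum>\<alpha>\<in>multi_indices_in (insert i I) L. h \<alpha>) =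
      (\<Sum>(k, \<beta>)\<in>(SIGMA k:{..L}. multi_indices_in I (L - k)). h (\<beta>(i := k)))"
  proof (rule sum.reindex_bij_witness[where i = "\<lambda>(k, \<beta>). \<beta>(i := k)" and j = "\<lambda>\<alpha>. (\<alpha> i, \<alpha>(i := 0))"])
    fix \<alpha> assume a: "\<alpha> \<in> multi_indices_in (insert i I) L"
    with s[of \<alpha> 0] show "(\<alpha> i, \<alpha>(i := 0)) \<in> (SIGMA k:{..L}. multi_indices_in I (L - k))"
      by (auto simp: multi_indices_in_def multi_indices_def)
  next
    fix p assume "p \<in> (SIGMA k:{..L}. multi_indices_in I (L - k))"
    then obtain k \<beta> where p: "p = (k, \<beta>)" "k \<le> L" "\<beta> \<in> multi_indices_in I (L - k)" by auto
    then have b: "\<beta> i = 0" using assms by (auto simp: multi_indices_in_def)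
    with s[of \<beta> k] p show "(case p of (k, \<beta>) \<Rightarrow> \<beta>(i := k)) \<in> multi_indices_in (insert i I) L"
      by (auto simp: multi_indices_in_def multi_indices_def)
    show "((case p of (k, \<beta>) \<Rightarrow> \<beta>(i := k)) i, (case p of (k, \<beta>) \<Rightarrow> \<beta>(i := k))(i := 0)) = p"
      using p b by auto
  qed auto
  also have "\<dots> = (\<Sum>k\<le>L. \<Sum>\<beta>\<in>multi_indices_in I (L - k). h (\<beta>(i := k)))"
    using fin by (subst sum.Sigma) auto
  finally show ?thesis .
qed

text \<open>Erasing coordinate \<open>i\<close> of \<open>x\<close> does not disturb the weight of
  \<beta>: its exponent there is 0, and 0^0 = 1.\<close>

lemma taylor_weight_update:
  fixes x :: "real ^ 'n::finite"
  assumes "\<beta> i = 0"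
  shows "taylor_weight (\<beta>(i := k)) x = (x $ i) ^ k / fact k * taylor_weight \<beta> (x - (x $ i) *\<^sub>R axis i 1)"
proof -
  have "(\<Prod>j\<in>UNIV - {i}. (x $ j) ^ (\<beta>(i := k)) j / fact ((\<beta>(i := k)) j)) =
     (\<Prod>j\<in>UNIV - {i}. ((x - (x $ i) *\<^sub>R axis i 1) $ j) ^ \<beta> j / fact (\<beta> j))"
    by (rule prod.cong) (auto simp: axis_def)
  then show ?thesis
    using assms by (simp add: taylor_weight_def prod.remove[of UNIV i])
qed

lemma coordinate_line_has_vector_derivative:
  fixes F :: "real ^ 'n::finite \<Rightarrow> 'b::real_normed_vector"
  assumes "Ck_on (Suc k) U F" "x + t *\<^sub>R axis i 1 \<in> U"
  shows "((\<lambda>t. F (x + t *\<^sub>R axis i 1)) has_vector_derivative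
    partial_deriv i F (x + t *\<^sub>R axis i 1)) (at t)"
proof -
  let ?p = "\<lambda>t. x + t *\<^sub>R axis i 1 :: real ^ 'n"
  have "(?p has_derivative (\<lambda>h. h *\<^sub>R axis i 1)) (at t)"
    by (auto intro!: derivative_eq_intros)
  from has_derivative_compose[OF this Ck_on_Suc_has_derivative[OF assms]]
  have "((\<lambda>t. F (?p t)) has_derivative
      (\<lambda>h. frechet_derivative F (at (?p t)) (h *\<^sub>R axis i 1))) (at t)" .
  moreover have "linear (frechet_derivative F (at (?p t)))"
    using Ck_on_Suc_has_derivative[OF assms] has_derivative_linear by blast
  ultimately show ?thesis
    by (simp add: has_vector_derivative_def partial_deriv_def linear_cmul)
qed

text \<open>One-variable Taylor expansion along the segment from the projection of \<open>x\<close>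
  with coordinate \<open>i\<close> erased to \<open>x\<close>. A uniform \<open>B\<close> exists
  because the derivative of order \<open>Suc L\<close> is continuous on the compact ball of radius
  \<rho>.\<close>

lemma taylor_coordinate_bound:
  fixes F :: "real ^ 'n::finite \<Rightarrow> 'b::real_normed_vector"
  assumes "Ck_on (Suc L) (ball 0 r) F" "\<rho> < r"
  obtains B where "0 \<le> B" "\<And>x. norm x \<le> \<rho> \<Longrightarrow>
    norm (F x - (\<Sum>k\<le>L. ((x $ i) ^ k / fact k) *\<^sub>R
      (partial_deriv i ^^ k) F (x - (x $ i) *\<^sub>R axis i 1))) \<le> B * norm x ^ Suc L"
proof -
  let ?F = "\<lambda>k. (partial_deriv i ^^ k) F"
  have "continuous_on (ball 0 r) (?F (Suc L))"
    using Ck_on_partial_deriv_funpow[of "Suc L" 0] assms(1) by simp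
  then have "continuous_on (cball 0 \<rho>) (?F (Suc L))"
    by (rule continuous_on_subset) (use assms(2) in auto)
  then have "bounded (?F (Suc L) ` cball 0 \<rho>)"
    by (rule compact_imp_bounded[OF compact_continuous_image[OF _ compact_cball]])
  then obtain B where B: "0 < B" "\<And>z. norm z \<le> \<rho> \<Longrightarrow> norm (?F (Suc L) z) \<le> B"
    unfolding bounded_pos by auto
  show thesis
  proof (rule that[of B])
    fix x :: "real ^ 'n"
    assume x: "norm x \<le> \<rho>"
    let ?s = "x $ i"
    let ?x = "x - ?s *\<^sub>R axis i 1"
    \<comment> \<open>No component grows in absolute value, so the whole segment stays in the ball
      where \<open>B\<close> is valid.\<close>
    have le: "norm (?x + t *\<^sub>R axis i 1) \<le> norm x" if "\<bar>t\<bar> \<le> \<bar>?s\<bar>" for t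
      by (rule norm_le_componentwise_cart) (use that in \<open>auto simp: axis_def\<close>)
    have "norm (?F 0 (?x + ?s *\<^sub>R axis i 1) - (\<Sum>k\<le>L. (?s ^ k / fact k) *\<^sub>R ?F k (?x + 0 *\<^sub>R axis i 1)))
        \<le> B * \<bar>?s\<bar> ^ Suc L"
    proof (rule taylor_remainder_bound[where F = "\<lambda>k t. ?F k (?x + t *\<^sub>R axis i 1)"])
      fix k t assume "k \<le> L" and t: "\<bar>t\<bar> \<le> \<bar>?s\<bar>"
      then have "Ck_on (k + Suc (L - k)) (ball 0 r) F" using assms(1) by simp
      then have "Ck_on (Suc (L - k)) (ball 0 r) (?F k)" by (rule Ck_on_partial_deriv_funpow)
      moreover have "?x + t *\<^sub>R axis i 1 \<in> ball 0 r" using le[OF t] x assms(2) by simp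
      ultimately show "((\<lambda>t. ?F k (?x + t *\<^sub>R axis i 1)) has_vector_derivative
          ?F (Suc k) (?x + t *\<^sub>R axis i 1)) (at t)"
        using coordinate_line_has_vector_derivative by fastforce
    next
      fix t assume "\<bar>t\<bar> \<le> \<bar>?s\<bar>"
      then show "norm (?F (Suc L) (?x + t *\<^sub>R axis i 1)) \<le> B"
        using B(2) le x order_trans by blast
    qed
    also have "\<dots> \<le> B * norm x ^ Suc L"
      using B(1) component_le_norm_cart[of x i] by (intro mult_left_mono power_mono) auto
    finally show "norm (F x - (\<Sum>k\<le>L. (?s ^ k / fact k) *\<^sub>R ?F k ?x)) \<le> B * norm x ^ Suc L"
      by simp
  qed (use B in simp)
qed

section \<open>Taylor's formula in several variables\<close>

text \<open>Since \<open>foldr\<close> applies the last list entry first, the list is extended at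
  its end: \<open>F\<close> is expanded in that variable, and the induction hypothesis at order
  \<open>L - k\<close> expands each coefficient in the earlier ones. Hence \<open>F\<close> and
  \<open>L\<close> vary in the induction, and \<open>x\<close> is confined to the coordinate
  subspace of the list.\<close>

lemma taylor_bound_on_coordinates:
  fixes F :: "real ^ 'n::finite \<Rightarrow> 'b::real_normed_vector"
  assumes "distinct is" "Ck_on (Suc L) (ball 0 r) F" "\<rho> < r"
  shows "\<exists>C\<ge>0. \<forall>x. norm x \<le> \<rho> \<longrightarrow> (\<forall>j. j \<notin> set is \<longrightarrow> x $ j = 0) \<longrightarrow>
    norm (F x - (\<Sum>\<alpha>\<in>multi_indices_in (set is) L.
      taylor_weight \<alpha> x *\<^sub>R foldr (\<lambda>i. partial_deriv i ^^ \<alpha> i) is F 0)) \<le> C * norm x ^ Suc L"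
  using assms(1,2)
proof (induction "is" arbitrary: F L rule: rev_induct)
  case Nil
  \<comment> \<open>For the empty list the only point is 0 and the only multi-index is zero, so the
    remainder vanishes.\<close>
  have "multi_indices_in (set []) L = {(\<lambda>_. 0) :: 'n \<Rightarrow> nat}" for L
    by (auto simp: multi_indices_in_def multi_indices_def)
  moreover have "x = 0" if "\<forall>j. x $ j = 0" for x :: "real ^ 'n"
    using that by (simp add: vec_eq_iff)
  ultimately show ?case by (intro exI[of _ 0]) (auto simp: taylor_weight_def)
next
  case (snoc i "is")
  let ?F = "\<lambda>k. (partial_deriv i ^^ k) F"
  let ?D = "\<lambda>\<alpha> F. foldr (\<lambda>i. partial_deriv i ^^ \<alpha> i) is F 0"
  let ?P = "\<lambda>k x. \<Sum>\<beta>\<in>multi_indices_in (set is) (L - k). taylor_weight \<beta> x *\<^sub>R ?D \<beta> (?F k)"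
  obtain B where B: "0 \<le> B" "\<And>x. norm x \<le> \<rho> \<Longrightarrow>
    norm (F x - (\<Sum>k\<le>L. ((x $ i) ^ k / fact k) *\<^sub>R ?F k (x - (x $ i) *\<^sub>R axis i 1))) \<le> B * norm x ^ Suc L"
    using taylor_coordinate_bound[OF snoc.prems(2) assms(3), of i] by blast
  \<comment> \<open>\<open>Q\<close> bundles the induction hypotheses for the coefficients, so that
    all constants \<open>C k\<close> can be chosen together.\<close>
  define Q where "Q k C \<longleftrightarrow> 0 \<le> C \<and> (\<forall>x. norm x \<le> \<rho> \<longrightarrow> (\<forall>j. j \<notin> set is \<longrightarrow> x $ j = 0) \<longrightarrow>
      norm (?F k x - ?P k x) \<le> C * norm x ^ Suc (L - k))" for k C
  have "\<exists>C. Q k C" if "k \<le> L" for k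
  proof -
    have "Ck_on (k + Suc (L - k)) (ball 0 r) F" using snoc.prems(2) that by simp
    then have "Ck_on (Suc (L - k)) (ball 0 r) (?F k)" by (rule Ck_on_partial_deriv_funpow)
    moreover have "distinct is" using snoc.prems(1) by simp
    ultimately show ?thesis unfolding Q_def by (intro snoc.IH)
  qed
  then obtain C where C: "\<And>k. k \<le> L \<Longrightarrow> Q k (C k)"
    by metis
  show ?case
  proof (intro exI[of _ "B + (\<Sum>k\<le>L. C k)"] conjI allI impI)
    show "0 \<le> B + (\<Sum>k\<le>L. C k)"
      using B(1) C by (auto simp: Q_def intro!: add_nonneg_nonneg sum_nonneg)
  next
    fix x :: "real ^ 'n"
    assume x: "norm x \<le> \<rho>" "\<forall>j. j \<notin> set (is @ [i]) \<longrightarrow> x $ j = 0"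
    let ?s = "x $ i"
    let ?x = "x - ?s *\<^sub>R axis i 1"
    have i: "i \<notin> set is" using snoc.prems(1) by simp
    \<comment> \<open>As \<open>i\<close> does not occur in \<open>is\<close>, changing the exponent
      at \<open>i\<close> affects only the innermost derivative.\<close>
    have D: "foldr (\<lambda>j. partial_deriv j ^^ (\<beta>(i := k)) j) (is @ [i]) F 0 = ?D \<beta> (?F k)" for \<beta> k
    proof -
      have "foldr (\<lambda>j. partial_deriv j ^^ (\<beta>(i := k)) j) is (?F k) =
          foldr (\<lambda>j. partial_deriv j ^^ \<beta> j) is (?F k)"
        by (rule foldr_cong) (use i in auto)
      then show ?thesis by simp
    qed
    have "(\<Sum>\<alpha>\<in>multi_indices_in (set (is @ [i])) L.
        taylor_weight \<alpha> x *\<^sub>R foldr (\<lambda>i. partial_deriv i ^^ \<alpha> i) (is @ [i]) F 0) =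
      (\<Sum>k\<le>L. \<Sum>\<beta>\<in>multi_indices_in (set is) (L - k).
        taylor_weight (\<beta>(i := k)) x *\<^sub>R ?D \<beta> (?F k))"
      using sum_multi_indices_in_insert[OF i, of "\<lambda>\<alpha>. taylor_weight \<alpha> x *\<^sub>R foldr (\<lambda>i. partial_deriv i ^^ \<alpha> i) (is @ [i]) F 0" L]
      unfolding D by simp
    also have "\<dots> = (\<Sum>k\<le>L. (?s ^ k / fact k) *\<^sub>R ?P k ?x)"
      unfolding scaleR_sum_right scaleR_scaleR
      by (intro sum.cong refl, subst taylor_weight_update) (use i in \<open>auto simp: multi_indices_in_def\<close>)
    finally have P: "(\<Sum>\<alpha>\<in>multi_indices_in (set (is @ [i])) L.
        taylor_weight \<alpha> x *\<^sub>R foldr (\<lambda>i. partial_deriv i ^^ \<alpha> i) (is @ [i]) F 0) =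
      (\<Sum>k\<le>L. (?s ^ k / fact k) *\<^sub>R ?P k ?x)" .
    have nx: "norm ?x \<le> norm x"
      by (rule norm_le_componentwise_cart) (auto simp: axis_def)
    have x': "\<forall>j. j \<notin> set is \<longrightarrow> ?x $ j = 0" using x(2) by (auto simp: axis_def)
    \<comment> \<open>The power \<open>k\<close> of \<open>?s\<close> and the power
      \<open>Suc (L - k)\<close> from the coefficient's remainder combine to
      \<open>Suc L\<close>.\<close>
    have k: "norm ((?s ^ k / fact k) *\<^sub>R (?F k ?x - ?P k ?x)) \<le> C k * norm x ^ Suc L" if "k \<le> L" for k
    proof -
      have "\<bar>?s ^ k / fact k\<bar> \<le> \<bar>?s\<bar> ^ k"
        by (simp add: power_abs divide_le_eq mult_le_cancel_left1 fact_ge_1)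
      also have "\<dots> \<le> norm x ^ k" by (intro power_mono component_le_norm_cart) auto
      finally have 1: "\<bar>?s ^ k / fact k\<bar> \<le> norm x ^ k" .
      have "norm (?F k ?x - ?P k ?x) \<le> C k * norm ?x ^ Suc (L - k)"
        using C[OF that] x' nx x(1) unfolding Q_def by auto
      also have "\<dots> \<le> C k * norm x ^ Suc (L - k)"
        using C[OF that] nx unfolding Q_def by (intro mult_left_mono power_mono) auto
      finally have "norm ((?s ^ k / fact k) *\<^sub>R (?F k ?x - ?P k ?x))
          \<le> norm x ^ k * (C k * norm x ^ Suc (L - k))"
        unfolding norm_scaleR using 1 by (intro mult_mono) auto
      also have "\<dots> = C k * norm x ^ (k + Suc (L - k))" by (simp only: power_add mult_ac)
      finally show ?thesis using that by simp
    qed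
    \<comment> \<open>The error has two sources: the expansion in the variable \<open>i\<close>, and
      the replacement of each coefficient by its own Taylor polynomial.\<close>
    have split: "F x - (\<Sum>k\<le>L. (?s ^ k / fact k) *\<^sub>R ?P k ?x) =
        (F x - (\<Sum>k\<le>L. (?s ^ k / fact k) *\<^sub>R ?F k ?x)) + (\<Sum>k\<le>L. (?s ^ k / fact k) *\<^sub>R (?F k ?x - ?P k ?x))"
      by (simp add: scaleR_diff_right sum_subtractf)
    have "norm (F x - (\<Sum>k\<le>L. (?s ^ k / fact k) *\<^sub>R ?P k ?x)) \<le>
        B * norm x ^ Suc L + (\<Sum>k\<le>L. C k * norm x ^ Suc L)"
      unfolding split by (intro norm_triangle_mono B(2) x(1) sum_norm_le k) auto
    then show "norm (F x - (\<Sum>\<alpha>\<in>multi_indices_in (set (is @ [i])) L.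
        taylor_weight \<alpha> x *\<^sub>R foldr (\<lambda>i. partial_deriv i ^^ \<alpha> i) (is @ [i]) F 0))
        \<le> (B + (\<Sum>k\<le>L. C k)) * norm x ^ Suc L"
      unfolding P by (simp only: distrib_right sum_distrib_right)
  qed
qed

text \<open>The list of all coordinates makes the support conditions vacuous, and its order is the
  one built into \<open>multi_deriv\<close>, so the previous bound applies verbatim.\<close>

lemma taylor_poly_bound:
  fixes g :: "real ^ (('n::{finite,linorder}) option) \<Rightarrow> 'k::real_normed_field"
  assumes "Ck_on (Suc L) (ball 0 r) (pullback g)" "\<rho> < r"
  obtains C where "0 \<le> C"
    "\<And>x. norm x \<le> \<rho> \<Longrightarrow> norm (pullback g x - taylor_poly L g x) \<le> C * norm x ^ Suc L"
proof -
  let ?is = "sorted_list_of_set (UNIV :: 'n set)"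
  have "taylor_poly L g = (\<lambda>x. \<Sum>\<alpha>\<in>multi_indices_in (set ?is) L. taylor_weight \<alpha> x *\<^sub>R
      foldr (\<lambda>i. partial_deriv i ^^ \<alpha> i) ?is (pullback g) 0)"
    unfolding taylor_poly_def multi_deriv_def[symmetric]
    by (intro ext sum.cong) (auto simp: multi_indices_in_def taylor_weight_def monomial_def
        multi_fact_def scaleR_conv_of_real prod_dividef)
  then have "\<exists>C\<ge>0. \<forall>x. norm x \<le> \<rho> \<longrightarrow> (\<forall>j. j \<notin> set ?is \<longrightarrow> x $ j = 0) \<longrightarrow>
      norm (pullback g x - taylor_poly L g x) \<le> C * norm x ^ Suc L"
    using taylor_bound_on_coordinates[OF distinct_sorted_list_of_set[of UNIV] assms] by (simp only:)
  then show thesis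
    using that by (auto simp only: set_sorted_list_of_set finite UNIV_I)
qed

subsection \<open>Functions on the sphere\<close>

text \<open>The derivatives in direction \<open>h\<close> are -(x . h)/s for \<open>s\<close> and (x
  . h)/s^3 for its inverse. Both involve only 1/s and linear functions, so proving the two claims
  together closes the induction.\<close>

lemma Ck_on_sqrt_one_minus_norm:
  fixes k :: nat
  defines "s \<equiv> \<lambda>x :: 'a::euclidean_space. sqrt (1 - (norm x)\<^sup>2)"
  shows "Ck_on k (ball 0 1) s \<and> Ck_on k (ball 0 1) (\<lambda>x. inverse (s x))"
proof (induction k)
  have pos: "0 < 1 - x \<bullet> x" if "x \<in> ball 0 1" for x :: 'a
    using that by (simp add: power2_norm_eq_inner[symmetric] abs_square_less_1)
  have s: "s = (\<lambda>x. sqrt (1 - x \<bullet> x))"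
    unfolding s_def power2_norm_eq_inner ..
  have nz: "s x \<noteq> 0" if "x \<in> ball 0 1" for x
    using pos[OF that] unfolding s by simp
  {
    case 0
    have "continuous_on (ball 0 1) s"
      unfolding s by (rule continuous_on_real_sqrt) (intro continuous_intros)
    moreover from this have "continuous_on (ball 0 1) (\<lambda>x. inverse (s x))"
      using nz by (intro continuous_on_inverse) auto
    ultimately show ?case by simp
  next
    case (Suc k)
    let ?i = "\<lambda>x. inverse (s x)"
    have h: "Ck_on k (ball 0 1) ?i" using Suc.IH by blast
    have lin: "Ck_on k (ball 0 1) (\<lambda>x. x \<bullet> b)" for b :: 'a
      by (rule Ck_on_bounded_linear[OF open_ball Ck_on_ident[OF open_ball] bounded_linear_inner_left])
    have cube: "Ck_on k (ball 0 1) (\<lambda>x. (x \<bullet> b) *\<^sub>R ?i x *\<^sub>R ?i x *\<^sub>R ?i x)" for b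
      by (rule Ck_on_scaleR[OF open_ball lin Ck_on_scaleR[OF open_ball h Ck_on_scaleR[OF open_ball h h]]])
    have ds: "(s has_derivative (\<lambda>h. (x \<bullet> h) *\<^sub>R (- 1 *\<^sub>R ?i x))) (at x)" if "x \<in> ball 0 1" for x
    proof -
      have 1: "((\<lambda>x. 1 - x \<bullet> x) has_derivative (\<lambda>h. - 2 * (x \<bullet> h))) (at x)"
        by (auto intro!: derivative_eq_intros simp: inner_commute)
      have 2: "(sqrt has_derivative (\<lambda>h. inverse (s x) / 2 * h)) (at (1 - x \<bullet> x))"
        using DERIV_real_sqrt[OF pos[OF that]] unfolding has_field_derivative_def s .
      show ?thesis
        using has_derivative_compose[OF 1 2] unfolding s by (simp add: mult_ac)
    qed
    have "Ck_on (Suc k) (ball 0 1) s"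
      by (rule Ck_on_SucI[OF open_ball ds], assumption)
        (rule Ck_on_scaleR[OF open_ball lin Ck_on_scaleR[OF open_ball Ck_on_const[OF open_ball] h]])
    moreover have "Ck_on (Suc k) (ball 0 1) ?i"
    proof (rule Ck_on_SucI[OF open_ball])
      show "(?i has_derivative (\<lambda>h. (x \<bullet> h) *\<^sub>R ?i x *\<^sub>R ?i x *\<^sub>R ?i x)) (at x)"
        if "x \<in> ball 0 1" for x
        using Deriv.has_derivative_inverse[OF nz[OF that] ds[OF that]] by (simp add: mult_ac)
    qed (rule cube)
    ultimately show ?case by blast
  }
qed

section \<open>The chart of the upper hemisphere\<close>

lemma hemisphere_param_zero: "hemisphere_param 0 = axis None 1"
  by (auto simp: hemisphere_param_def axis_def vec_eq_iff split: option.split)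

lemma inner_option_vec:
  fixes v w :: "real ^ ('n::finite option)"
  shows "v \<bullet> w = v $ None * w $ None + (\<chi> j. v $ Some j) \<bullet> (\<chi> j. w $ Some j)"
  by (simp add: inner_vec_def UNIV_option_conv sum.reindex)

lemma norm_hemisphere_param:
  assumes "norm x \<le> 1"
  shows "norm (hemisphere_param x) = 1"
proof -
  have "(norm x)\<^sup>2 \<le> 1" using assms by (simp add: abs_square_le_1)
  then have "(norm (hemisphere_param x))\<^sup>2 = 1"
    unfolding power2_norm_eq_inner[of "hemisphere_param x"]
    by (simp add: inner_option_vec hemisphere_param_def power2_norm_eq_inner
        flip: power2_eq_square)
  then show ?thesis by (intro power2_eq_imp_eq[of _ 1]) simp_all
qed

text \<open>Forgetting the last coordinate inverts the chart on the closed upper hemisphere, where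
  that coordinate is the nonnegative square root.\<close>

lemma hemisphere_param_project:
  fixes z :: "real ^ ('n::finite option)"
  assumes "norm z = 1" "0 \<le> z $ None"
  defines "x \<equiv> \<chi> j. z $ Some j"
  shows "hemisphere_param x = z" "norm x = sqrt (1 - (z $ None)\<^sup>2)"
proof -
  have "z \<bullet> z = 1" using assms(1) by (simp add: norm_eq_1)
  then have n: "(norm x)\<^sup>2 = 1 - (z $ None)\<^sup>2"
    using power2_norm_eq_inner[of x] inner_option_vec[of z z, folded x_def]
    by (simp add: power2_eq_square[of "z $ None"])
  show "norm x = sqrt (1 - (z $ None)\<^sup>2)"
    using n by (metis norm_ge_zero real_sqrt_unique)
  show "hemisphere_param x = z"
    unfolding hemisphere_param_def n using assms(2)
    by (auto simp: vec_eq_iff x_def split: option.split)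
qed

lemma Ck_on_hemisphere_param: "Ck_on k (ball 0 1) (hemisphere_param :: real ^ 'n::finite \<Rightarrow> _)"
proof -
  \<comment> \<open>The chart is this linear embedding plus the square root times the pole, so it
    inherits the smoothness of both.\<close>
  define E :: "real ^ 'n \<Rightarrow> real ^ ('n option)"
    where "E x = (\<chi> i. case i of None \<Rightarrow> 0 | Some j \<Rightarrow> x $ j)" for x
  have "linear E"
    by (rule linearI) (auto simp: E_def vec_eq_iff split: option.split)
  then have "bounded_linear E" by (rule linear_conv_bounded_linear[THEN iffD1])
  then have "Ck_on k (ball 0 1) E"
    by (rule Ck_on_bounded_linear[OF open_ball Ck_on_ident[OF open_ball]])
  then have "Ck_on k (ball 0 1) (\<lambda>x. E x + sqrt (1 - (norm x)\<^sup>2) *\<^sub>R axis None 1)"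
    using Ck_on_sqrt_one_minus_norm[of k]
    by (intro Ck_on_add Ck_on_scaleR Ck_on_const open_ball) auto
  moreover have "E x + sqrt (1 - (norm x)\<^sup>2) *\<^sub>R axis None 1 = hemisphere_param x" for x
    by (auto simp: E_def hemisphere_param_def axis_def vec_eq_iff split: option.split)
  ultimately show ?thesis by (simp only:)
qed

lemma Ck_sphereE:
  assumes "f \<in> Ck_sphere k" "norm y = 1"
  obtains U F where "open U" "y \<in> U" "Ck_on k U F" "\<And>z. z \<in> U \<Longrightarrow> norm z = 1 \<Longrightarrow> F z = f z"
proof -
  have "y \<in> sphere 0 1" using assms(2) by simp
  with assms(1) obtain U F where "open U" "y \<in> U" "Ck_on k U F" "\<forall>z\<in>U \<inter> sphere 0 1. F z = f z"
    unfolding Ck_sphere_def by blast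
  then show thesis by (intro that[of U F]) auto
qed

lemma Ck_on_pullback:
  fixes f :: "real ^ ('n::finite option) \<Rightarrow> 'k::real_normed_vector"
  assumes "f \<in> Ck_sphere k"
  obtains r where "0 < r" "Ck_on k (ball 0 r) (pullback f)"
proof -
  obtain U F where U: "open U" "axis None 1 \<in> U" "Ck_on k U F"
    and F: "\<And>z. z \<in> U \<Longrightarrow> norm z = 1 \<Longrightarrow> F z = f z"
    by (rule Ck_sphereE[OF assms, of "axis None 1"]) auto
  \<comment> \<open>The extension \<open>F\<close> is controlled only on \<open>U\<close>, so the
    radius is shrunk until the chart maps into \<open>U\<close>; the unit ball guarantees that its
    values lie on the sphere.\<close>
  let ?V = "hemisphere_param -` U \<inter> ball 0 1 :: (real ^ 'n) set"
  have "continuous_on (ball 0 1) (hemisphere_param :: real ^ 'n \<Rightarrow> _)"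
    by (rule Ck_on_imp_continuous_on[OF Ck_on_hemisphere_param])
  then have "open ?V"
    using U(1) by (simp add: continuous_on_open_vimage)
  moreover have "0 \<in> ?V" using U(2) by (simp add: hemisphere_param_zero)
  ultimately obtain r where r: "0 < r" "ball 0 r \<subseteq> ?V"
    using open_contains_ball by blast
  have "Ck_on k (ball 0 r) (\<lambda>x. F (hemisphere_param x))"
    by (rule Ck_on_compose[OF open_ball U(3) Ck_on_subset[OF Ck_on_hemisphere_param]]) (use r(2) in auto)
  then have "Ck_on k (ball 0 r) (pullback f)"
  proof (rule Ck_on_cong[OF open_ball])
    fix x :: "real ^ 'n"
    assume "x \<in> ball 0 r"
    then have "hemisphere_param x \<in> U" "norm (hemisphere_param x) = 1"
      using r(2) by (auto intro!: norm_hemisphere_param)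
    then show "F (hemisphere_param x) = pullback f x" by (simp add: F pullback_def)
  qed
  with r(1) show thesis by (rule that)
qed

section \<open>Rotations of functions on the sphere\<close>

lemma orthogonal_matrix_norm:
  fixes R :: "real ^ 'm ^ 'm"
  assumes "orthogonal_matrix R"
  shows "norm (R *v x) = norm x"
  using assms by (intro orthogonal_transformation_norm)
    (simp add: orthogonal_transformation_matrix matrix_of_matrix_vector_mul)

lemma Ck_sphere_rotate:
  fixes R :: "real ^ 'm ^ 'm"
  assumes "f \<in> Ck_sphere k" "orthogonal_matrix R"
  shows "f \<circ> (\<lambda>x. R *v x) \<in> Ck_sphere k"
proof -
  have "\<exists>V H. open V \<and> y \<in> V \<and> Ck_on k V H \<and>
      (\<forall>z\<in>V \<inter> sphere 0 1. H z = (f \<circ> (\<lambda>x. R *v x)) z)" if "y \<in> sphere 0 1" for y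
  proof -
    have "norm (R *v y) = 1"
      using that by (simp add: orthogonal_matrix_norm[OF assms(2)])
    then obtain U F where U: "open U" "R *v y \<in> U" "Ck_on k U F"
      and F: "\<And>z. z \<in> U \<Longrightarrow> norm z = 1 \<Longrightarrow> F z = f z"
      using Ck_sphereE[OF assms(1)] by metis
    \<comment> \<open>A local extension of the rotated function is the rotated extension, on the
      preimage of its domain.\<close>
    let ?V = "(\<lambda>x. R *v x) -` U"
    have V: "open ?V"
      by (rule open_vimage[OF U(1)]) (simp add: matrix_vector_mult_linear_continuous_on)
    have "Ck_on k ?V (\<lambda>x. F (R *v x))"
      by (rule Ck_on_compose[OF V U(3) Ck_on_bounded_linear[OF V Ck_on_ident[OF V]]]) auto
    then show ?thesis
      using V U(2) F by (intro exI[of _ ?V] exI[of _ "\<lambda>x. F (R *v x)"])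
        (auto simp: orthogonal_matrix_norm[OF assms(2)])
  qed
  moreover have "(f \<circ> (\<lambda>x. R *v x)) x = 0" if "x \<notin> sphere 0 1" for x
    using assms(1) that by (auto simp: Ck_sphere_def orthogonal_matrix_norm[OF assms(2)])
  ultimately show ?thesis unfolding Ck_sphere_def by blast
qed

section \<open>Boundedness and the local approximation error\<close>

lemma continuous_on_Ck_sphere:
  assumes "f \<in> Ck_sphere k"
  shows "continuous_on (sphere 0 1) f"
  unfolding continuous_on_eq_continuous_within
proof
  fix y :: 'a
  assume y: "y \<in> sphere 0 1"
  then obtain U F where U: "open U" "y \<in> U" "Ck_on k U F"
    and F: "\<And>z. z \<in> U \<Longrightarrow> norm z = 1 \<Longrightarrow> F z = f z"
    using Ck_sphereE[OF assms, of y] by auto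
  have "continuous_on (sphere 0 1 \<inter> U) F"
    using Ck_on_imp_continuous_on[OF U(3)] continuous_on_subset by blast
  then have "continuous_on (sphere 0 1 \<inter> U) f"
    by (rule continuous_on_eq) (use F in auto)
  then have "continuous (at y within (sphere 0 1 \<inter> U)) f"
    using y U(2) by (simp add: continuous_on_eq_continuous_within)
  moreover have "at y within (sphere 0 1 \<inter> U) = at y within sphere 0 1"
    by (rule at_within_nhd[OF U(2,1)]) auto
  ultimately show "continuous (at y within sphere 0 1) f" by simp
qed

text \<open>A real supremum is meaningful only over a bounded set; here compactness of the sphere
  provides the bound.\<close>

lemma bdd_above_norm_diff_cap:
  fixes f g :: "'a::euclidean_space \<Rightarrow> 'k::real_normed_vector"
  assumes "f \<in> Ck_sphere k" "g \<in> Ck_sphere m"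
  shows "bdd_above ((\<lambda>z. norm (f z - g z)) ` cap \<delta> y)"
proof -
  have "continuous_on (sphere 0 1) (\<lambda>z. norm (f z - g z))"
    by (intro continuous_intros continuous_on_Ck_sphere[OF assms(1)] continuous_on_Ck_sphere[OF assms(2)])
  then have "bounded ((\<lambda>z. norm (f z - g z)) ` sphere 0 1)"
    by (rule compact_imp_bounded[OF compact_continuous_image[OF _ compact_sphere]])
  then show ?thesis
    by (rule bdd_above_mono[OF bounded_imp_bdd_above]) (auto simp: cap_def)
qed

lemma center_in_cap: "norm y = 1 \<Longrightarrow> 0 < \<delta> \<Longrightarrow> y \<in> cap \<delta> y"
  by (simp add: cap_def gc_dist_def norm_eq_1)

text \<open>One competitor \<open>g\<close> bounds the infimum from above. The center of the cap
  makes each supremum one over a nonempty set, hence nonnegative, and this in turn bounds the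
  infimum from below.\<close>

lemma local_error_bounds:
  fixes f :: "'a::euclidean_space \<Rightarrow> 'k::real_normed_vector"
  assumes "f \<in> Ck_sphere k" "G \<subseteq> Ck_sphere m" "norm y = 1" "0 < \<delta>"
    and "g \<in> G" "\<And>z. z \<in> cap \<delta> y \<Longrightarrow> norm (f z - g z) \<le> M"
  shows "0 \<le> local_error \<delta> G f y" "local_error \<delta> G f y \<le> M"
proof -
  let ?S = "\<lambda>h. SUP z\<in>cap \<delta> y. norm (f z - h z)"
  have nonneg: "0 \<le> ?S h" if "h \<in> G" for h
    using bdd_above_norm_diff_cap[OF assms(1)] that assms(2)
    by (intro cSUP_upper2[OF _ center_in_cap[OF assms(3,4)]]) auto
  then show "0 \<le> local_error \<delta> G f y"
    unfolding local_error_def using assms(5) by (intro cINF_greatest) auto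
  have "bdd_below (?S ` G)" using nonneg by (intro bdd_belowI[of _ 0]) auto
  moreover have "?S g \<le> M"
    using assms(6) center_in_cap[OF assms(3,4)] by (intro cSUP_least) auto
  ultimately show "local_error \<delta> G f y \<le> M"
    unfolding local_error_def by (intro cINF_lower2[OF _ assms(5)])
qed

text \<open>Makes surjectivity of the Taylor map on the ansatz space applicable to the Taylor
  polynomial of an arbitrary function.\<close>

lemma taylor_poly_in_polys: "taylor_poly L g \<in> polys L"
proof -
  have sum_apply: "(\<Sum>a\<in>A. h a) x = (\<Sum>a\<in>A. h a x)"
    for A and h :: "'c \<Rightarrow> 'd \<Rightarrow> 'e::comm_monoid_add" and x
    by (induction A rule: infinite_finite_induct) auto
  have expand: "taylor_poly L g = (\<Sum>\<alpha>\<in>multi_indices L.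
      fscale (multi_deriv \<alpha> (pullback g) 0 / of_nat (multi_fact \<alpha>)) (monomial \<alpha>))"
    by (rule ext) (simp add: taylor_poly_def fscale_def sum_apply)
  show ?thesis
    unfolding polys_def expand by (intro kfun.span_sum kfun.span_scale kfun.span_base imageI)
qed

text \<open>The cap lies in the open upper hemisphere, and the norm of the projected point is the
  sine of its great circle distance to the pole, which is at most that distance.\<close>

lemma cap_axis_project:
  fixes z :: "real ^ ('n::finite option)"
  assumes "z \<in> cap \<delta> (axis None 1)" "\<delta> \<le> pi / 2"
  obtains x where "hemisphere_param x = z" "norm x \<le> \<delta>"
proof -
  have nz: "norm z = 1" and d: "arccos (z $ None) < \<delta>"
    using assms(1) by (auto simp: cap_def gc_dist_def inner_axis')
  have b: "-1 \<le> z $ None" "z $ None \<le> 1"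
    using component_le_norm_cart[of z None] nz by auto
  have "0 < z $ None"
  proof (rule ccontr)
    assume "\<not> 0 < z $ None"
    then have "arccos 0 \<le> arccos (z $ None)" using b by (intro arccos_le_arccos) auto
    then show False using d assms(2) by simp
  qed
  then have 1: "hemisphere_param (\<chi> j. z $ Some j) = z"
    and 2: "norm (\<chi> j. z $ Some j) = sqrt (1 - (z $ None)\<^sup>2)"
    using hemisphere_param_project[OF nz] by auto
  have "sqrt (1 - (z $ None)\<^sup>2) = sin (arccos (z $ None))"
    using b by (simp add: sin_arccos)
  also have "\<dots> \<le> arccos (z $ None)" using b by (intro sin_x_le_x arccos_lbound)
  finally show thesis using that[OF 1] 2 d by simp
qed

text \<open>The transpose is the adjoint of \<open>R\<close>, so it preserves the inner product that
  defines the great circle distance.\<close>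

lemma cap_rotate:
  fixes R :: "real ^ 'm ^ 'm"
  assumes "orthogonal_matrix R" "z \<in> cap \<delta> (R *v e)"
  shows "transpose R *v z \<in> cap \<delta> e"
proof -
  have "e \<bullet> (transpose R *v z) = (R *v e) \<bullet> z"
    by (metis dot_lmul_matrix inner_commute transpose_matrix_vector)
  moreover have "orthogonal_matrix (transpose R)"
    using assms(1) by (simp add: orthogonal_matrix_def)
  ultimately show ?thesis
    using assms(2) orthogonal_matrix_norm[of "transpose R" z] by (simp add: cap_def gc_dist_def)
qed

lemma rotation_matrix_transpose:
  fixes R :: "real ^ 'm ^ 'm"
  shows "rotation_matrix R \<Longrightarrow> rotation_matrix (transpose R)"
  by (simp add: rotation_matrix_def orthogonal_matrix_def)

section \<open>Transport to the pole and the final estimate\<close>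

theorem lemma3p3:
  fixes L :: nat
    and G :: "(real ^ (('n::{finite,linorder}) option) \<Rightarrow> 'k::real_or_complex) set"
    and f :: "real ^ ('n option) \<Rightarrow> 'k"
    and y :: "real ^ ('n option)"
  assumes "finite_dim_subspace G"
    and "G \<subseteq> Cinf_sphere"
    and "rotation_invariant G"
    and "taylor_poly L ` G = polys L"
    and "f \<in> Ck_sphere (L + 1)"
    and "y \<in> sphere 0 1"
  shows "(\<lambda>\<delta>. local_error \<delta> G f y) \<in> O[at_right 0](\<lambda>\<delta>. \<delta> ^ (L + 1))"
proof -
  let ?e = "axis None 1 :: real ^ ('n option)"
  \<comment> \<open>Rotations act transitively on the sphere only from dimension 2 on; in dimension
    1 the identity is the only rotation.\<close>
  have "CARD('n option) \<ge> 2" by (simp add: card_UNIV_option Suc_le_eq)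
  moreover have ny: "norm y = 1" using assms(6) by simp
  ultimately obtain R where R: "rotation_matrix R" "R *v ?e = y"
    using rotation_matrix_exists_basis by metis
  then have oR: "orthogonal_matrix R" by (simp add: rotation_matrix_def)
  have G: "G \<subseteq> Ck_sphere (Suc L)" using assms(2) by (auto simp: Cinf_sphere_def)
  let ?f = "f \<circ> (\<lambda>x. R *v x)"
  have f: "?f \<in> Ck_sphere (Suc L)" using Ck_sphere_rotate[OF assms(5) oR] by simp
  obtain g where g: "g \<in> G" "taylor_poly L g = taylor_poly L ?f"
    using taylor_poly_in_polys[of L ?f] assms(4) by (metis imageE)
  obtain r1 where r1: "0 < r1" "Ck_on (Suc L) (ball 0 r1) (pullback ?f)"
    using Ck_on_pullback[OF f] by blast
  obtain r2 where r2: "0 < r2" "Ck_on (Suc L) (ball 0 r2) (pullback g)"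
    using Ck_on_pullback g(1) G by blast
  \<comment> \<open>Halving makes \<rho> strictly smaller than both radii, as the Taylor bounds
    require, and the minimum with \<open>pi\<close> keeps the caps in the upper hemisphere.\<close>
  define \<rho> where "\<rho> = min (min r1 r2) pi / 2"
  have \<rho>: "0 < \<rho>" "\<rho> < r1" "\<rho> < r2" "\<rho> \<le> pi / 2"
    using r1(1) r2(1) pi_gt_zero by (auto simp: \<rho>_def min_def)
  obtain C1 where C1: "0 \<le> C1" "\<And>x. norm x \<le> \<rho> \<Longrightarrow>
      norm (pullback ?f x - taylor_poly L ?f x) \<le> C1 * norm x ^ Suc L"
    using taylor_poly_bound[OF r1(2) \<rho>(2)] by blast
  obtain C2 where C2: "0 \<le> C2" "\<And>x. norm x \<le> \<rho> \<Longrightarrow>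
      norm (pullback g x - taylor_poly L g x) \<le> C2 * norm x ^ Suc L"
    using taylor_poly_bound[OF r2(2) \<rho>(3)] by blast
  let ?g = "g \<circ> (\<lambda>x. transpose R *v x)"
  \<comment> \<open>Invariance under the inverse rotation returns the approximant at the pole to
    \<open>y\<close> without leaving \<open>G\<close>.\<close>
  have "?g \<in> G"
    using assms(3) rotation_matrix_transpose[OF R(1)] g(1)
    unfolding rotation_invariant_def by blast
  have bound: "norm (f z - ?g z) \<le> (C1 + C2) * \<delta> ^ Suc L"
    if \<delta>: "\<delta> < \<rho>" and z: "z \<in> cap \<delta> y" for \<delta> z
  proof -
    have "transpose R *v z \<in> cap \<delta> ?e" using cap_rotate[OF oR] z R(2) by simp
    moreover have "\<delta> \<le> pi / 2" using \<delta> \<rho>(4) by simp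
    ultimately obtain x where x: "hemisphere_param x = transpose R *v z" "norm x \<le> \<delta>"
      by (rule cap_axis_project)
    have "R *v (transpose R *v z) = z"
      using oR by (simp add: matrix_vector_mul_assoc orthogonal_matrix_def del: transpose_matrix_vector)
    \<comment> \<open>The common Taylor polynomial cancels, which leaves the two remainders.\<close>
    then have split: "f z - ?g z = (pullback ?f x - taylor_poly L ?f x) - (pullback g x - taylor_poly L g x)"
      by (simp add: pullback_def x(1) g(2))
    have "norm x \<le> \<rho>" using x(2) \<delta> by simp
    then have "norm (f z - ?g z) \<le> C1 * norm x ^ Suc L + C2 * norm x ^ Suc L"
      unfolding split by (intro norm_triangle_le_diff add_mono C1(2) C2(2))
    also have "\<dots> \<le> (C1 + C2) * \<delta> ^ Suc L"
      unfolding distrib_right[symmetric] using C1(1) C2(1) x(2) by (intro mult_left_mono power_mono) auto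
    finally show ?thesis .
  qed
  \<comment> \<open>The constant \<open>C1 + C2\<close> does not depend on \<delta>, and
    nonnegativity of the error removes the norm.\<close>
  have "norm (local_error \<delta> G f y) \<le> (C1 + C2) * norm (\<delta> ^ (L + 1))"
    if "0 < \<delta>" "\<delta> < \<rho>" for \<delta>
    using local_error_bounds[OF assms(5) G ny that(1) \<open>?g \<in> G\<close> bound[OF that(2)]] that(1) by simp
  then have "eventually (\<lambda>\<delta>. norm (local_error \<delta> G f y) \<le> (C1 + C2) * norm (\<delta> ^ (L + 1))) (at_right 0)"
    unfolding eventually_at_right_field using \<rho>(1) by blast
  then show ?thesis by (rule bigoI)
qed

end
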